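(* Let $p\ge5$ be a prime and let $\mathcal{R}_i^{(p)}$, $i\ge1$, be the length of the $i$-th zero run of the sequence $T_n\bmod p$, where $T_n=\frac{1}{n+1}\binom{3n+1}{n}$ for $n\ge0$. (1) If $p\equiv1\pmod3$, then the left-to-right record values of $\langle\mathcal{R}_i^{(p)}\rangle_{i\ge1}$ are precisely the positive numbers of the forms $\frac{p^r-1}{6}$ and $\frac{p^r-4}{3}$ for $r\ge1$. (2) If $p\equiv2\pmod3$, then the left-to-right record values of $\langle\mathcal{R}_i^{(p)}\rangle_{i\ge1}$ are precisely the following: (a) for each odd $r\ge1$, the numbers $\frac{p^r-5}{6}$ and $\frac{p^r-2}{3}$, except that $\frac{p^r-5}{6}$ is omitted when $(p,r)=(5,1)$, where it equals $0$; (b) for each even $r\ge2$, the numbers $\frac{p^r-1}{6}$ and $\frac{p^r-4}{3}$.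
   Context: For a prime $p$, a zero run of $T_n\bmod p$ is a maximal (nonempty) interval of consecutive indices $n\ge 0$ on which $T_n\equiv 0\pmod p$. Zero runs are numbered from left to right starting with $1$, and $\mathcal{R}_i^{(p)}$ denotes the length (number of indices) of the $i$-th zero run. For a sequence $\langle a_i\rangle_{i\ge1}$, the entry $a_k$ is a left-to-right maximum, or record, if $a_k\ge a_i$ for every $i<k$ (ties are allowed); a record value is a value attained by some record. *)

theory Defs
  imports Complex_Main "HOL-Number_Theory.Number_Theory"
begin

definition T :: "nat \<Rightarrow> nat" where
  "T n = ((3 * n + 1) choose n) div (n + 1)"

text \<open>The division in the definition of \<open>T\<close> is exact.\<close>

lemma Suc_dvd_choose: "(n + 1) dvd ((3 * n + 1) choose n)"
proof -
  have eq: "3 * n + 1 - n = 2 * n + 1" by simp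
  have "(n + 1) * ((3 * n + 1) choose (n + 1)) = (3 * n + 1) * ((3 * n + 1 - 1) choose n)"
    using binomial_absorption[of n "3 * n + 1"] by (simp only: Suc_eq_plus1)
  also have "\<dots> = (2 * n + 1) * ((3 * n + 1) choose n)"
    using binomial_absorb_comp[of "3 * n + 1" n] by (simp only: eq)
  finally have "(n + 1) * ((3 * n + 1) choose (n + 1)) = (2 * n + 1) * ((3 * n + 1) choose n)" .
  then have "(n + 1) dvd (2 * n + 1) * ((3 * n + 1) choose n)"
    by (metis dvd_triv_left)
  moreover have "coprime (n + 1) (2 * n + 1)"
  proof -
    have "d dvd 1" if "d dvd n + 1" "d dvd 2 * n + 1" for d
    proof -
      have "d dvd 2 * (n + 1) - (2 * n + 1)"
        using that by (meson dvd_diff_nat dvd_mult)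
      then show ?thesis by simp
    qed
    then show ?thesis by (simp add: coprime_def)
  qed
  ultimately show ?thesis
    using coprime_dvd_mult_right_iff by blast
qed

lemma real_T: "real (T n) = 1 / (real n + 1) * real ((3 * n + 1) choose n)"
  unfolding T_def using Suc_dvd_choose[of n] by (simp add: real_of_nat_div add.commute)

text \<open>Sets of consecutive indices. Unbounded sets are not excluded a priori.\<close>

definition consecutive :: "nat set \<Rightarrow> bool" where
  "consecutive I \<longleftrightarrow> (\<forall>a\<in>I. \<forall>c\<in>I. {a..c} \<subseteq> I)"

definition zero_interval :: "nat \<Rightarrow> nat set \<Rightarrow> bool" where
  "zero_interval p I \<longleftrightarrow> I \<noteq> {} \<and> consecutive I \<and> (\<forall>n\<in>I. [T n = 0] (mod p))"

definition zero_run :: "nat \<Rightarrow> nat set \<Rightarrow> bool" where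
  "zero_run p I \<longleftrightarrow> zero_interval p I \<and> (\<forall>J. zero_interval p J \<and> I \<subseteq> J \<longrightarrow> J = I)"

definition left_of :: "nat set \<Rightarrow> nat set \<Rightarrow> bool" where
  "left_of J I \<longleftrightarrow> (\<forall>x\<in>J. \<forall>y\<in>I. x < y)"

text \<open>Distinct zero runs are comparable under \<open>left_of\<close>, and only finitely many runs lie to the
  left of a given one, so ``numbered from left to right starting with 1'' means that run number
  \<open>i\<close> has exactly \<open>i - 1\<close> runs to its left.\<close>

definition is_ith_zero_run :: "nat \<Rightarrow> nat \<Rightarrow> nat set \<Rightarrow> bool" where
  "is_ith_zero_run p i I \<longleftrightarrow> zero_run p I \<and> card {J. zero_run p J \<and> left_of J I} + 1 = i"

lemma zero_runD:
  assumes "zero_run p I"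
  shows "I \<noteq> {}" "consecutive I" "\<And>n. n \<in> I \<Longrightarrow> [T n = 0] (mod p)"
    "\<And>J. zero_interval p J \<Longrightarrow> I \<subseteq> J \<Longrightarrow> J = I"
  using assms unfolding zero_run_def zero_interval_def by blast+

lemma consecutiveD: "consecutive I \<Longrightarrow> a \<in> I \<Longrightarrow> c \<in> I \<Longrightarrow> a \<le> x \<Longrightarrow> x \<le> c \<Longrightarrow> x \<in> I"
  unfolding consecutive_def by (meson atLeastAtMost_iff subsetD)

lemma zero_run_cases:
  assumes I: "zero_run p I" and J: "zero_run p J"
  shows "I = J \<or> left_of I J \<or> left_of J I"
proof (cases "I \<inter> J = {}")
  case False
  then obtain z where z: "z \<in> I" "z \<in> J" by blast
  have cI: "consecutive I" and cJ: "consecutive J"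
    using zero_runD(2) I J by blast+
  note sI = consecutiveD[OF cI] and sJ = consecutiveD[OF cJ]
  have "x \<in> I \<union> J" if ac: "a \<in> I \<union> J" "c \<in> I \<union> J" "a \<le> x" "x \<le> c" for a c x
  proof (cases "x \<le> z")
    case True
    with ac(1,3) z sI[of a z x] sJ[of a z x] show ?thesis by blast
  next
    case False
    then have "z \<le> x" by simp
    with ac(2,4) z sI[of z c x] sJ[of z c x] show ?thesis by blast
  qed
  then have "consecutive (I \<union> J)"
    unfolding consecutive_def by (meson atLeastAtMost_iff subsetI)
  then have "zero_interval p (I \<union> J)"
    using zero_runD(1,3)[OF I] zero_runD(1,3)[OF J] unfolding zero_interval_def by blast
  then have "I \<union> J = I" "I \<union> J = J"
    using zero_runD(4)[OF I] zero_runD(4)[OF J] by blast+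
  then show ?thesis by simp
next
  case True
  have cI: "consecutive I" and cJ: "consecutive J"
    using zero_runD(2) I J by blast+
  have ?thesis if nl: "\<not> left_of I J"
  proof -
    obtain x y where xy: "x \<in> I" "y \<in> J" "y \<le> x"
      using nl unfolding left_of_def by (auto simp: not_less)
    have "u < v" if "u \<in> J" "v \<in> I" for u v
    proof (rule ccontr)
      assume "\<not> u < v"
      then have "v \<le> u" by simp
      show False
      proof (cases "y \<le> v")
        case True
        then have "v \<in> J"
          using consecutiveD[OF cJ \<open>y \<in> J\<close> \<open>u \<in> J\<close>] \<open>v \<le> u\<close> by blast
        then show False using \<open>I \<inter> J = {}\<close> \<open>v \<in> I\<close> by blast
      next
        case False
        then have "v \<le> y" by simp
        then have "y \<in> I"
          using consecutiveD[OF cI \<open>v \<in> I\<close> \<open>x \<in> I\<close>] \<open>y \<le> x\<close> by blast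
        then show False using \<open>I \<inter> J = {}\<close> xy by blast
      qed
    qed
    then show ?thesis unfolding left_of_def by blast
  qed
  then show ?thesis by blast
qed

lemma finite_zero_runs_left_of:
  assumes "zero_run p I"
  shows "finite {J. zero_run p J \<and> left_of J I}"
proof -
  obtain y where "y \<in> I"
    using zero_runD(1)[OF assms] by blast
  then have "{J. zero_run p J \<and> left_of J I} \<subseteq> Pow {..<y}"
    by (auto simp: left_of_def)
  then show ?thesis by (rule finite_subset) simp
qed

lemma is_ith_zero_run_unique:
  assumes I: "is_ith_zero_run p i I" and J: "is_ith_zero_run p i J"
  shows "I = J"
proof -
  have less: "card {K. zero_run p K \<and> left_of K A} < card {K. zero_run p K \<and> left_of K B}"
    if A: "zero_run p A" and B: "zero_run p B" and AB: "left_of A B" for A B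
  proof (rule psubset_card_mono[OF finite_zero_runs_left_of[OF B]])
    obtain a where a: "a \<in> A"
      using zero_runD(1)[OF A] by blast
    have "\<not> left_of A A" using a by (auto simp: left_of_def)
    moreover have "left_of K B" if "left_of K A" for K
      using that AB a unfolding left_of_def by (meson less_trans)
    ultimately show "{K. zero_run p K \<and> left_of K A} \<subset> {K. zero_run p K \<and> left_of K B}"
      using A AB by blast
  qed
  have "zero_run p I" "zero_run p J"
    using I J by (auto simp: is_ith_zero_run_def)
  from zero_run_cases[OF this] show ?thesis
  proof (elim disjE)
    assume "left_of I J"
    from less[OF \<open>zero_run p I\<close> \<open>zero_run p J\<close> this] show ?thesis
      using I J unfolding is_ith_zero_run_def by linarith
  next
    assume "left_of J I"
    from less[OF \<open>zero_run p J\<close> \<open>zero_run p I\<close> this] show ?thesis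
      using I J unfolding is_ith_zero_run_def by linarith
  qed
qed

text \<open>The value is meaningful when the \<open>i\<close>-th zero run exists and is finite. If some run failed to
  exist or were infinite, there would be only finitely many runs, hence only finitely many values of
  \<open>zero_run_length p\<close>; so any statement giving it infinitely many record values excludes this.\<close>

definition zero_run_length :: "nat \<Rightarrow> nat \<Rightarrow> nat" where
  "zero_run_length p i = card (THE I. is_ith_zero_run p i I)"

text \<open>Sequences are indexed from 1; the value at index 0 plays no role.\<close>

definition is_record :: "(nat \<Rightarrow> 'a::linorder) \<Rightarrow> nat \<Rightarrow> bool" where
  "is_record a k \<longleftrightarrow> k \<ge> 1 \<and> (\<forall>i. 1 \<le> i \<and> i < k \<longrightarrow> a k \<ge> a i)"

definition record_values :: "(nat \<Rightarrow> 'a::linorder) \<Rightarrow> 'a set" where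
  "record_values a = {a k | k. is_record a k}"

end

theory Submission
  imports Defs
begin

text \<open>
  With \<open>m = n + 1\<close> one has \<open>T n = (3m - 2)! / (m! (2m - 1)!)\<close>, so by Legendre's formula \<open>T n\<close>
  vanishes modulo \<open>p\<close> iff for some level \<open>q = p ^ j\<close>, \<open>j \<ge> 1\<close>, the residue of \<open>m\<close> modulo \<open>q\<close> lies
  strictly between \<open>\<lfloor>(q + 1) / 3\<rfloor>\<close> and \<open>(q + 1) / 2\<close> or strictly between \<open>\<lfloor>(2q + 1) / 3\<rfloor>\<close> and \<open>q\<close>. The
  endpoints \<open>e\<close> of these gaps satisfy \<open>3e \<equiv> \<plusminus>1\<close>, \<open>2e \<equiv> 1\<close> or \<open>e \<equiv> 0\<close> modulo every lower level, which
  keeps them out of all gaps of lower level. Hence the gaps are nested or separated, every zero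
  run is a single gap, and its length depends only on the level and the kind of gap. For each
  length the first gap, the one in \<open>[0, q]\<close>, is a run, and the positions of these first gaps are
  ordered like their lengths; so every run length is a record value.
\<close>

section \<open>Legendre's formula and the vanishing criterion\<close>

text \<open>Legendre's formula, cut off at \<open>N\<close> because later quotients are 0. From
  \<open>n\<close> to \<open>Suc n\<close> the quotient by \<open>p ^ j\<close> grows by 1 exactly
  when \<open>p ^ j dvd Suc n\<close>, and the multiplicity of \<open>p\<close> in
  \<open>Suc n\<close> counts these \<open>j\<close>.\<close>

lemma multiplicity_fact:
  fixes p :: nat
  assumes "prime p" and "n < p ^ Suc N"
  shows "multiplicity p (fact n) = (\<Sum>j=1..N. n div p ^ j)"
  using assms(2)
proof (induction n)
  case (Suc n)
  let ?k = "multiplicity p (Suc n)"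
  have p: "p > 1" using assms(1) by (rule prime_gt_1_nat)
  have "p ^ ?k \<le> Suc n" by (intro dvd_imp_le multiplicity_dvd) simp
  then have "p ^ ?k < p ^ Suc N" using Suc.prems by linarith
  then have "?k \<le> N" using p by (simp only: power_strict_increasing_iff less_Suc_eq_le)
  have "multiplicity p (fact (Suc n)) = multiplicity p (Suc n * fact n)" by simp
  also have "\<dots> = ?k + multiplicity p (fact n)"
    by (rule prime_elem_multiplicity_mult_distrib) (use assms(1) in auto)
  also have "?k = card ({1..N} \<inter> {j. p ^ j dvd Suc n})"
  proof -
    have "{1..N} \<inter> {j. p ^ j dvd Suc n} = {1..?k}"
      using \<open>?k \<le> N\<close> p by (auto simp: power_dvd_iff_le_multiplicity)
    then show ?thesis by simp
  qed
  also have "\<dots> = (\<Sum>j=1..N. if p ^ j dvd Suc n then 1 else 0)"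
    by (simp add: sum.If_cases)
  also have "multiplicity p (fact n) = (\<Sum>j=1..N. n div p ^ j)"
    using Suc by simp
  finally show ?case
    by (simp add: sum.distrib[symmetric] div_Suc dvd_eq_mod_eq_0 mod_Suc cong: if_cong)
       (rule sum.cong, auto simp: div_Suc)
qed simp

lemma T_mult_fact: "T n * (fact (n + 1) * fact (2 * n + 1)) = fact (3 * n + 1)"
proof -
  have T: "T n * (n + 1) = (3 * n + 1) choose n"
    unfolding T_def by (rule dvd_div_mult_self[OF Suc_dvd_choose])
  have "T n * (fact (n + 1) * fact (2 * n + 1)) = (T n * (n + 1)) * fact n * fact (2 * n + 1)"
    by (simp only: Suc_eq_plus1[symmetric] fact_Suc[of n] of_nat_id mult.assoc mult.left_commute)
  also have "\<dots> = fact n * fact (3 * n + 1 - n) * ((3 * n + 1) choose n)"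
  proof -
    have eq: "3 * n + 1 - n = 2 * n + 1" by simp
    show ?thesis unfolding T eq by (simp only: mult_ac)
  qed
  also have "\<dots> = fact (3 * n + 1)"
    by (rule binomial_fact_lemma) simp
  finally show ?thesis .
qed

lemma T_pos: "T n > 0"
  using T_mult_fact[of n] by (metis fact_nonzero mult_zero_left neq0_conv)

text \<open>By the following lemma, \<open>good (p ^ j) ((n + 1) mod p ^ j)\<close> says that level \<open>j\<close> contributes
  nothing to the multiplicity of \<open>p\<close> in \<open>T n\<close>.\<close>

definition good :: "nat \<Rightarrow> nat \<Rightarrow> bool" where
  "good q d \<longleftrightarrow> 3 * d \<le> q + 1 \<or> (q + 1 \<le> 2 * d \<and> 3 * d \<le> 2 * q + 1)"

text \<open>With \<open>n = q * a + c\<close> the multiples of \<open>q\<close> cancel, since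
  \<open>a + 2 * a = 3 * a\<close>. What remains compares the quotients of \<open>c + 1\<close>,
  \<open>2 * c + 1\<close> and \<open>3 * c + 1\<close>, each at most 2. If
  \<open>c + 1 = q\<close>, the residue wraps to 0, which is good.\<close>

lemma div_carry:
  fixes n q :: nat
  assumes "q \<ge> 2"
  shows "(n + 1) div q + (2 * n + 1) div q \<le> (3 * n + 1) div q"
    and "(n + 1) div q + (2 * n + 1) div q = (3 * n + 1) div q \<longleftrightarrow> good q ((n + 1) mod q)"
proof -
  define a c where "a = n div q" and "c = n mod q"
  have n: "n = q * a + c" and c: "c < q" using assms by (auto simp: a_def c_def)
  have 1: "(n + 1) div q = a + (if c + 1 = q then 1 else 0)"
          "(n + 1) mod q = (if c + 1 = q then 0 else c + 1)"
    using assms by (auto simp: a_def c_def div_Suc mod_Suc)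
  have "2 * n + 1 = (2 * c + 1) + q * (2 * a)" "3 * n + 1 = (3 * c + 1) + q * (3 * a)"
    by (auto simp: n algebra_simps)
  then have 2: "(2 * n + 1) div q = 2 * a + (2 * c + 1) div q"
               "(3 * n + 1) div q = 3 * a + (3 * c + 1) div q"
    using assms by (simp_all only: div_mult_self2)
  have small: "x div q = (if x < q then 0 else if x < 2 * q then 1 else 2)" if "x < 3 * q" for x
    using that by (auto intro!: div_nat_eqI)
  have 3: "(2 * c + 1) div q = (if 2 * c + 1 < q then 0 else 1)"
    using small[of "2 * c + 1"] c by auto
  have 4: "(3 * c + 1) div q = (if 3 * c + 1 < q then 0 else if 3 * c + 1 < 2 * q then 1 else 2)"
    using small[of "3 * c + 1"] c by auto
  show "(n + 1) div q + (2 * n + 1) div q \<le> (3 * n + 1) div q"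
    unfolding 1 2 3 4 using c assms by auto
  show "(n + 1) div q + (2 * n + 1) div q = (3 * n + 1) div q \<longleftrightarrow> good q ((n + 1) mod q)"
    unfolding 1 2 3 4 good_def using c assms by auto
qed

lemma T_cong_0_iff:
  assumes "prime p"
  shows "[T n = 0] (mod p) \<longleftrightarrow> (\<exists>j\<ge>1. \<not> good (p ^ j) ((n + 1) mod p ^ j))"
proof -
  \<comment> \<open>Large enough that \<open>p ^ j\<close> exceeds \<open>3 * n + 1\<close> from
    level \<open>N\<close> on, so the truncated Legendre sums are complete.\<close>
  define N where "N = 3 * n + 2"
  have p: "p \<ge> 2" using assms by (rule prime_ge_2_nat)
  have big: "3 * n + 1 < p ^ j" if "j \<ge> N" for j
  proof -
    have "3 * n + 1 < j" using that by (simp add: N_def)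
    also have "j < 2 ^ j" by (rule less_exp)
    also have "(2::nat) ^ j \<le> p ^ j" using p by (intro power_mono) auto
    finally show ?thesis .
  qed
  have le: "m < p ^ Suc N" if "m \<le> 3 * n + 1" for m
    using big[of "Suc N"] that by linarith
  have "multiplicity p (T n) + (multiplicity p (fact (n + 1)) + multiplicity p (fact (2 * n + 1)))
      = multiplicity p (T n * (fact (n + 1) * fact (2 * n + 1)))"
    using assms T_pos[of n]
    by (simp add: prime_elem_multiplicity_mult_distrib del: fact_Suc)
  also have "\<dots> = multiplicity p (fact (3 * n + 1))"
    by (simp only: T_mult_fact)
  finally have sum: "multiplicity p (T n) +
      (\<Sum>j=1..N. (n + 1) div p ^ j + (2 * n + 1) div p ^ j) = (\<Sum>j=1..N. (3 * n + 1) div p ^ j)"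
    by (simp add: multiplicity_fact[OF assms le] sum.distrib del: fact_Suc)
  have pj: "p ^ j \<ge> 2" if "j \<ge> 1" for j
    using that p self_le_power[of p j] by linarith
  have "[T n = 0] (mod p) \<longleftrightarrow> multiplicity p (T n) \<noteq> 0"
    using assms T_pos[of n] by (simp add: cong_0_iff prime_multiplicity_gt_zero_iff[symmetric])
  also have "\<dots> \<longleftrightarrow> (\<Sum>j=1..N. (n + 1) div p ^ j + (2 * n + 1) div p ^ j)
                       \<noteq> (\<Sum>j=1..N. (3 * n + 1) div p ^ j)"
    using sum by linarith
  also have "\<dots> \<longleftrightarrow> \<not> (\<forall>j\<in>{1..N}. (n + 1) div p ^ j + (2 * n + 1) div p ^ j = (3 * n + 1) div p ^ j)"
    (is "sum ?f _ \<noteq> sum ?g _ \<longleftrightarrow> _")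
  proof -
    \<comment> \<open>Termwise inequality together with equal sums forces equality in every
      term.\<close>
    have "?f j \<le> ?g j" if "j \<in> {1..N}" for j
      using that pj div_carry(1) by simp
    then show ?thesis
      using sum_mono_inv[of ?f "{1..N}" ?g] sum.cong[of "{1..N}" "{1..N}" ?f ?g] by blast
  qed
  also have "\<dots> \<longleftrightarrow> (\<exists>j\<in>{1..N}. \<not> good (p ^ j) ((n + 1) mod p ^ j))"
    using div_carry(2)[OF pj] by auto
  also have "\<dots> \<longleftrightarrow> (\<exists>j\<ge>1. \<not> good (p ^ j) ((n + 1) mod p ^ j))"
  proof -
    have "good (p ^ j) ((n + 1) mod p ^ j)" if "j > N" for j
      using big[of j] that by (auto simp: good_def)
    then show ?thesis by (metis atLeastAtMost_iff not_le)
  qed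
  finally show ?thesis .
qed

section \<open>Gaps of bad residues and their endpoints\<close>

text \<open>The flag selects the gap below \<open>q\<close> (\<open>True\<close>) or the one below \<open>(q + 1) div 2\<close>. The endpoints
  themselves are not in the gap, and they refer to \<open>n + 1\<close> rather than to the index \<open>n\<close>.\<close>

definition lo :: "bool \<Rightarrow> nat \<Rightarrow> nat" where
  "lo b q = (if b then 2 * q + 1 else q + 1) div 3"

definition hi :: "bool \<Rightarrow> nat \<Rightarrow> nat" where
  "hi b q = (if b then q else (q + 1) div 2)"

lemma not_good_iff:
  assumes "odd q" and "d < q"
  shows "\<not> good q d \<longleftrightarrow> (\<exists>b. lo b q < d \<and> d < hi b q)"
proof -
  obtain k where "q = 2 * k + 1" using assms(1) by (rule oddE)
  then show ?thesis using assms(2) unfolding good_def lo_def hi_def ex_bool_eq by auto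
qed

lemma hi_le: "odd q \<Longrightarrow> hi b q \<le> q"
  by (auto simp: hi_def elim: oddE)

lemma not_good_between:
  assumes "odd q" and "a * q + lo b q < m" and "m < a * q + hi b q"
  shows "\<not> good q (m mod q)"
proof -
  define d where "d = m - a * q"
  have m: "m = d + a * q" using assms(2) by (simp add: d_def)
  have d: "lo b q < d" "d < hi b q" using assms(2,3) by (auto simp: m)
  have "d < q" using d hi_le[OF assms(1), of b] by linarith
  then have "m mod q = d" by (simp add: m)
  then show ?thesis using d \<open>d < q\<close> not_good_iff[OF assms(1)] by auto
qed

text \<open>The residue \<open>d\<close> satisfies \<open>3d = qt - 1\<close> or
  \<open>3d = qt + 1\<close>, and \<open>0 \<le> d < q\<close> confines \<open>t\<close> to 0, ...,
  3. Only \<open>t = 1\<close> and \<open>t = 2\<close> can occur. For \<open>3d = 2q - 1\<close>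
  the bound \<open>q + 1 \<le> 2 * d\<close> amounts to \<open>q \<ge> 5\<close>.\<close>

lemma good_third:
  assumes "3 * e + 1 = q * s \<or> 3 * e = q * s + 1" and q: "q \<ge> 5"
  shows "good q (e mod q)"
proof -
  define a d where "a = e div q" and "d = e mod q"
  have e: "e = q * a + d" and d: "d < q" using q by (auto simp: a_def d_def)
  define t where "t = int s - 3 * int a"
  have t: "3 * int d + 1 = int q * t \<or> 3 * int d = int q * t + 1"
  proof -
    have "3 * int e + 1 = int q * int s \<or> 3 * int e = int q * int s + 1"
      using assms(1) by (metis of_nat_1 of_nat_add of_nat_mult of_nat_numeral)
    then show ?thesis by (auto simp: t_def e algebra_simps)
  qed
  have "int q * t < int q * 4" using t d q by (elim disjE) linarith+
  moreover have "int q * (- 1) < int q * t" using t d q by (elim disjE) linarith+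
  moreover have "int q > 0" using q by simp
  ultimately have "t < 4" "- 1 < t" by (simp_all only: mult_less_cancel_left_pos)
  then have "t = 0 \<or> t = 1 \<or> t = 2 \<or> t = 3" by auto
  with t have "good q d"
    unfolding good_def using d q by (elim disjE) (simp; presburger)+
  then show ?thesis by (simp add: d_def)
qed

lemma good_half:
  assumes "2 * e = q * s + 1" and q: "q \<ge> 5"
  shows "good q (e mod q)"
proof -
  define a d where "a = e div q" and "d = e mod q"
  have e: "e = q * a + d" and d: "d < q" using q by (auto simp: a_def d_def)
  define t where "t = int s - 2 * int a"
  have t: "2 * int d = int q * t + 1"
  proof -
    have "2 * int e = int q * int s + 1"
      using assms(1) by (metis of_nat_1 of_nat_add of_nat_mult of_nat_numeral)
    then show ?thesis by (auto simp: t_def e algebra_simps)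
  qed
  have "int q * t < int q * 2" using t d q by linarith
  moreover have "int q * (- 1) < int q * t" using t d q by linarith
  moreover have "int q > 0" using q by simp
  ultimately have "t < 2" "- 1 < t" by (simp_all only: mult_less_cancel_left_pos)
  then have "t = 0 \<or> t = 1" by auto
  with t have "good q d"
    unfolding good_def using d q by (elim disjE) (simp; presburger)+
  then show ?thesis by (simp add: d_def)
qed

section \<open>Numbering runs by their left ends\<close>

lemma Inf_Ico: "x < y \<Longrightarrow> Inf {x..<y} = x" for x y :: nat
  by (rule cInf_eq_minimum) auto

lemma left_of_iff_Inf:
  assumes "zero_run p I" and "zero_run p J"
  shows "left_of J I \<longleftrightarrow> Inf J < Inf I"
proof -
  have in_I: "Inf I \<in> I" and in_J: "Inf J \<in> J"
    using assms zero_runD(1) Inf_nat_def1 by blast+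
  show ?thesis
  proof
    assume "left_of J I"
    then show "Inf J < Inf I" using in_I in_J by (auto simp: left_of_def)
  next
    assume less: "Inf J < Inf I"
    then have "\<not> left_of I J" "I \<noteq> J"
      unfolding left_of_def using in_I in_J by (meson less_asym, auto)
    then show "left_of J I" using zero_run_cases[OF assms] by blast
  qed
qed

lemma inj_on_Inf_zero_runs: "inj_on Inf {I. zero_run p I}"
proof (rule inj_onI)
  fix I J assume "I \<in> {I. zero_run p I}" "J \<in> {I. zero_run p I}" and eq: "Inf I = Inf J"
  then have r: "zero_run p I" "zero_run p J" by auto
  show "I = J" using zero_run_cases[OF r] left_of_iff_Inf r eq by auto
qed

lemma ex_ith_zero_run:
  assumes "infinite {I. zero_run p I}" and "i \<ge> 1"
  shows "\<exists>I. is_ith_zero_run p i I"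
proof -
  define M where "M = Inf ` {I. zero_run p I}"
  have M: "infinite M"
    unfolding M_def using assms(1) finite_imageD inj_on_Inf_zero_runs by blast
  \<comment> \<open>\<open>enumerate\<close> counts from 0, so the left end at position
    \<open>i - 1\<close> has exactly \<open>i - 1\<close> left ends below it.\<close>
  obtain I where I: "zero_run p I" "Inf I = enumerate M (i - 1)"
    using enumerate_in_set[OF M, of "i - 1"] by (auto simp: M_def)
  have "Inf ` {J. zero_run p J \<and> left_of J I} = {m \<in> M. m < Inf I}"
    using left_of_iff_Inf[OF I(1)] by (auto simp: M_def)
  also have "\<dots> = enumerate M ` {..<i - 1}"
    unfolding I(2) using M enumerate_in_set[OF M] enumerate_Ex[OF M] by (fastforce simp: image_iff)
  finally have "card (Inf ` {J. zero_run p J \<and> left_of J I}) = i - 1"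
    using inj_enumerate[OF M] by (simp add: card_image inj_on_subset)
  moreover have "inj_on Inf {J. zero_run p J \<and> left_of J I}"
    by (rule inj_on_subset[OF inj_on_Inf_zero_runs]) auto
  ultimately have "card {J. zero_run p J \<and> left_of J I} = i - 1"
    by (simp add: card_image)
  then show ?thesis using I(1) assms(2) by (auto simp: is_ith_zero_run_def)
qed

lemma zero_run_length_eq: "is_ith_zero_run p i I \<Longrightarrow> zero_run_length p i = card I"
  unfolding zero_run_length_def
  by (metis is_ith_zero_run_unique the_equality)

lemma is_ith_zero_run_left_of:
  assumes I: "is_ith_zero_run p i I" and J: "is_ith_zero_run p j J" and "i < j"
  shows "left_of I J"
proof (rule ccontr)
  assume "\<not> left_of I J"
  have r: "zero_run p I" "zero_run p J" using I J by (auto simp: is_ith_zero_run_def)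
  have "Inf J \<le> Inf I" using \<open>\<not> left_of I J\<close> left_of_iff_Inf[OF r(2,1)] by simp
  then have "{K. zero_run p K \<and> left_of K J} \<subseteq> {K. zero_run p K \<and> left_of K I}"
    using left_of_iff_Inf r by fastforce
  then have "card {K. zero_run p K \<and> left_of K J} \<le> card {K. zero_run p K \<and> left_of K I}"
    by (rule card_mono[OF finite_zero_runs_left_of[OF r(1)]])
  then show False using I J \<open>i < j\<close> by (auto simp: is_ith_zero_run_def)
qed

text \<open>Counts the integers strictly between the endpoints; it is positive exactly when
  \<open>lo b q + 1 < hi b q\<close>, the form in which nonemptiness of a gap is used.\<close>

definition len :: "bool \<Rightarrow> nat \<Rightarrow> nat" where
  "len b q = hi b q - 1 - lo b q"

section \<open>Gaps and zero runs at the levels \<open>p ^ j\<close>\<close>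

context
  fixes p :: nat
  assumes prime: "prime p" and p5: "p \<ge> 5"
begin

lemma odd_power: "odd (p ^ j)"
  using prime p5 prime_odd_nat by auto

lemma power_mod_3: "p ^ j mod 3 \<noteq> 0"
proof -
  have "\<not> 3 dvd p" using prime p5 primes_dvd_imp_eq[of 3 p] by auto
  then show ?thesis
    using prime_dvd_power_nat[of 3 p j] by (auto simp: dvd_eq_mod_eq_0)
qed

lemma power_ge_5: "j \<ge> 1 \<Longrightarrow> p ^ j \<ge> 5"
  using p5 self_le_power[of p j] by linarith

lemma power_ratio: "i < j \<Longrightarrow> 5 * p ^ i \<le> p ^ j"
proof -
  assume "i < j"
  then have "p * p ^ i \<le> p ^ j" using p5 by (simp flip: power_Suc add: power_increasing)
  moreover have "5 * p ^ i \<le> p * p ^ i" using p5 by simp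
  ultimately show ?thesis by linarith
qed

text \<open>Since 3 does not divide \<open>p ^ j\<close>, the rounding in \<open>lo\<close> leaves
  three times the endpoint within 1 of a multiple of \<open>p ^ j\<close>, hence of every lower
  \<open>p ^ i\<close>.\<close>

lemma good_lo:
  assumes "1 \<le> i" and "i \<le> j"
  shows "good (p ^ i) ((a * p ^ j + lo b (p ^ j)) mod p ^ i)"
proof -
  obtain s where s: "p ^ j = p ^ i * s"
    using assms(2) by (metis le_imp_power_dvd dvdE)
  let ?e = "a * p ^ j + lo b (p ^ j)" and ?c = "if b then 2 else 1 :: nat"
  have "3 * lo b (p ^ j) + 1 = ?c * p ^ j \<or> 3 * lo b (p ^ j) = ?c * p ^ j + 1"
    using power_mod_3[of j] unfolding lo_def by (cases b; simp; presburger)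
  moreover have "(3 * a + ?c) * p ^ j = p ^ i * (s * (3 * a + ?c))"
    by (simp only: s ac_simps)
  ultimately have "3 * ?e + 1 = p ^ i * (s * (3 * a + ?c)) \<or> 3 * ?e = p ^ i * (s * (3 * a + ?c)) + 1"
    by (simp only: distrib_right distrib_left) linarith
  then show ?thesis using power_ge_5[OF assms(1)] by (rule good_third)
qed

lemma good_hi:
  assumes "1 \<le> i" and "i \<le> j"
  shows "good (p ^ i) ((a * p ^ j + hi b (p ^ j)) mod p ^ i)"
proof -
  obtain s where s: "p ^ j = p ^ i * s"
    using assms(2) by (metis le_imp_power_dvd dvdE)
  show ?thesis
  proof (cases b)
    case True
    then have "a * p ^ j + hi b (p ^ j) = p ^ i * (s * (a + 1))"
      by (simp add: hi_def s algebra_simps)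
    then show ?thesis by (simp add: good_def)
  next
    case False
    then have "2 * hi b (p ^ j) = p ^ j + 1"
      using odd_power[of j] by (auto simp: hi_def)
    moreover have "(2 * a + 1) * p ^ j = p ^ i * (s * (2 * a + 1))"
      by (simp only: s ac_simps)
    ultimately have "2 * (a * p ^ j + hi b (p ^ j)) = p ^ i * (s * (2 * a + 1)) + 1"
      by (simp only: distrib_right distrib_left)
    then show ?thesis using power_ge_5[OF assms(1)] by (rule good_half)
  qed
qed

text \<open>Above level \<open>k\<close> nothing needs checking: there \<open>n + 1\<close> is at
  most a fifth of \<open>p ^ i\<close>, below the first gap.\<close>

lemma T_nonzeroI:
  assumes "n + 1 \<le> p ^ k" and "\<And>i. 1 \<le> i \<Longrightarrow> i \<le> k \<Longrightarrow> good (p ^ i) ((n + 1) mod p ^ i)"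
  shows "\<not> [T n = 0] (mod p)"
proof -
  have "good (p ^ i) ((n + 1) mod p ^ i)" if "i > k" for i
    using power_ratio[OF that] assms(1) by (simp add: good_def)
  then show ?thesis using assms(2) T_cong_0_iff[OF prime] by (meson not_le)
qed

text \<open>Gaps concern \<open>n + 1\<close>. Values strictly between two endpoints therefore
  belong to indices from the lower endpoint itself up to the upper one minus 2.\<close>

lemma zero_interval_Ico:
  assumes "j \<ge> 1" and "lo b (p ^ j) + 1 < hi b (p ^ j)"
  shows "zero_interval p {a * p ^ j + lo b (p ^ j)..<a * p ^ j + hi b (p ^ j) - 1}"
  unfolding zero_interval_def consecutive_def T_cong_0_iff[OF prime]
  using assms not_good_between[OF odd_power[of j], of a b] by fastforce

lemma zero_intervalD:
  "zero_interval p I \<Longrightarrow> n \<in> I \<Longrightarrow> [T n = 0] (mod p)"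
  "zero_interval p I \<Longrightarrow> consecutive I"
  by (auto simp: zero_interval_def)

lemma zero_interval_subset_Ico:
  assumes "zero_interval p J" and "n \<in> J" and "x \<le> n" and "n < y"
    and "x = 0 \<or> \<not> [T (x - 1) = 0] (mod p)" and "\<not> [T y = 0] (mod p)"
  shows "J \<subseteq> {x..<y}"
proof
  fix m assume m: "m \<in> J"
  have xy: "x = 0 \<or> x - 1 \<notin> J" "y \<notin> J" using assms zero_intervalD(1) by blast+
  note c = consecutiveD[OF zero_intervalD(2)[OF assms(1)]]
  have "x \<le> m" using c[OF m assms(2), of "x - 1"] xy(1) assms(3) by (cases "x \<le> m") auto
  moreover have "m < y" using c[OF assms(2) m, of y] xy(2) assms(4) by (cases "m < y") auto
  ultimately show "m \<in> {x..<y}" by simp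
qed

lemma finite_zero_interval:
  assumes "zero_interval p I"
  shows "finite I"
proof -
  obtain n where n: "n \<in> I" using assms by (auto simp: zero_interval_def)
  have "n + 1 < p ^ (n + 1)" using p5 by (intro power_gt_expt) auto
  \<comment> \<open>The barrier is the index just before \<open>p ^ (n + 1)\<close>: the residue 0
    is good at every level up to \<open>n + 1\<close>.\<close>
  then have "I \<subseteq> {0..<p ^ (n + 1) - 1}"
  proof (intro zero_interval_subset_Ico[OF assms n])
    show "\<not> [T (p ^ (n + 1) - 1) = 0] (mod p)"
      using p5 by (intro T_nonzeroI[of _ "n + 1"]) (auto simp: good_def dvd_imp_mod_0 le_imp_power_dvd simp del: power_Suc)
  qed auto
  then show ?thesis by (rule finite_subset) simp
qed

text \<open>In the first period both endpoints are at most \<open>p ^ j\<close>, so no higher level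
  can cover them. The neighbours \<open>lo - 1\<close> and \<open>hi - 1\<close>, whose successors
  are the endpoints, thus stop the run.\<close>

lemma zero_run_initial:
  assumes j: "j \<ge> 1" and b: "lo b (p ^ j) + 1 < hi b (p ^ j)"
  shows "zero_run p {lo b (p ^ j)..<hi b (p ^ j) - 1}"
  unfolding zero_run_def
proof (intro conjI allI impI)
  show "zero_interval p {lo b (p ^ j)..<hi b (p ^ j) - 1}"
    using zero_interval_Ico[OF assms, of 0] by simp
  fix J assume J: "zero_interval p J \<and> {lo b (p ^ j)..<hi b (p ^ j) - 1} \<subseteq> J"
  have "lo b (p ^ j) \<ge> 1" using power_ge_5[OF j] by (auto simp: lo_def)
  moreover have "hi b (p ^ j) \<le> p ^ j" by (rule hi_le[OF odd_power])
  ultimately have "J \<subseteq> {lo b (p ^ j)..<hi b (p ^ j) - 1}"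
    using b J good_lo[of _ j 0 b] good_hi[of _ j 0 b]
    by (intro zero_interval_subset_Ico[of J "lo b (p ^ j)"] disjI2 T_nonzeroI[of _ j]) auto
  then show "J = {lo b (p ^ j)..<hi b (p ^ j) - 1}" using J by blast
qed

text \<open>Any interval of the largest level met by a run is the whole run, because its outer
  neighbours are not covered by intervals of that or any lower level.\<close>

lemma zero_run_form:
  assumes I: "zero_run p I"
  obtains j a b where "j \<ge> 1" and "lo b (p ^ j) + 1 < hi b (p ^ j)"
    and "I = {a * p ^ j + lo b (p ^ j)..<a * p ^ j + hi b (p ^ j) - 1}"
proof -
  have zI: "zero_interval p I" using I by (simp add: zero_run_def)
  have fin: "finite I" by (rule finite_zero_interval[OF zI])
  \<comment> \<open>The levels that are bad somewhere on the run. A bad residue at \<open>n\<close>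
    forces \<open>p ^ j < 3 * (n + 1)\<close>, so finiteness of the run bounds them.\<close>
  define L where "L = {j. j \<ge> 1 \<and> (\<exists>n\<in>I. \<not> good (p ^ j) ((n + 1) mod p ^ j))}"
  have "L \<subseteq> {..3 * (Max I + 1)}"
  proof
    fix j assume "j \<in> L"
    then obtain n where n: "n \<in> I" "\<not> good (p ^ j) ((n + 1) mod p ^ j)" by (auto simp: L_def)
    have "p ^ j < 3 * ((n + 1) mod p ^ j)" using n(2) by (simp add: good_def)
    also have "\<dots> \<le> 3 * (n + 1)" by (intro mult_left_mono mod_less_eq_dividend) simp
    also have "\<dots> \<le> 3 * (Max I + 1)" using Max_ge[OF fin n(1)] by simp
    finally have "p ^ j < 3 * (Max I + 1)" .
    moreover have "j < p ^ j" using p5 by (intro power_gt_expt) auto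
    ultimately show "j \<in> {..3 * (Max I + 1)}" by simp
  qed
  then have finL: "finite L" by (rule finite_subset) simp
  have "L \<noteq> {}"
    using zI by (auto simp: L_def zero_interval_def T_cong_0_iff[OF prime])
  define j where "j = Max L"
  have "j \<in> L" unfolding j_def by (rule Max_in[OF finL \<open>L \<noteq> {}\<close>])
  then obtain n where j: "j \<ge> 1" and n: "n \<in> I" "\<not> good (p ^ j) ((n + 1) mod p ^ j)"
    by (auto simp: L_def)
  define a where "a = (n + 1) div p ^ j"
  have "(n + 1) mod p ^ j < p ^ j" using power_ge_5[OF j] by (intro mod_less_divisor) linarith
  then obtain b where b: "lo b (p ^ j) < (n + 1) mod p ^ j" "(n + 1) mod p ^ j < hi b (p ^ j)"
    using not_good_iff[OF odd_power] n(2) by blast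
  let ?x = "a * p ^ j + lo b (p ^ j)" and ?y = "a * p ^ j + hi b (p ^ j)"
  have split: "n + 1 = a * p ^ j + (n + 1) mod p ^ j"
    unfolding a_def by (rule div_mult_mod_eq[symmetric])
  have xy: "?x < n + 1" "n + 1 < ?y" using b by (subst split; simp)+
  have out: "k \<notin> I" if "\<And>i. 1 \<le> i \<Longrightarrow> i \<le> j \<Longrightarrow> good (p ^ i) ((k + 1) mod p ^ i)" for k
  proof
    assume "k \<in> I"
    then have "[T k = 0] (mod p)" by (rule zero_intervalD(1)[OF zI])
    then obtain i where i: "i \<ge> 1" "\<not> good (p ^ i) ((k + 1) mod p ^ i)"
      using T_cong_0_iff[OF prime] by blast
    then have "i \<in> L" using \<open>k \<in> I\<close> by (auto simp: L_def)
    then have "i \<le> j" unfolding j_def by (rule Max_ge[OF finL])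
    then show False using that i by blast
  qed
  have x1: "?x \<ge> 1" using power_ge_5[OF j] by (auto simp: lo_def)
  have y1: "?y \<ge> 1" using xy by linarith
  have "?x - 1 \<notin> I" using good_lo[of _ j a b] x1 by (intro out) (simp only: le_add_diff_inverse2)
  moreover have "?y - 1 \<notin> I"
    using good_hi[of _ j a b] y1 by (intro out) (simp only: le_add_diff_inverse2)
  ultimately have "I \<subseteq> {?x..<?y - 1}"
  proof (intro subsetI)
    fix m assume m: "m \<in> I" and notin: "?x - 1 \<notin> I" "?y - 1 \<notin> I"
    note c = consecutiveD[OF zero_intervalD(2)[OF zI]]
    have "?x \<le> m" using c[OF m n(1), of "?x - 1"] notin(1) xy by linarith
    moreover have "m < ?y - 1" using c[OF n(1) m, of "?y - 1"] notin(2) xy by linarith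
    ultimately show "m \<in> {?x..<?y - 1}" by simp
  qed
  moreover have b': "lo b (p ^ j) + 1 < hi b (p ^ j)" using b by linarith
  ultimately have "I = {?x..<?y - 1}"
    using I zero_interval_Ico[OF j b', of a] unfolding zero_run_def by blast
  with j b' that show thesis by blast
qed

section \<open>Run lengths as record values\<close>

text \<open>The factor 5 between levels makes every gap of a lower level no longer than any gap of a
  higher one. Within a level the gap below \<open>q\<close> is the later and at least as long. The
  case \<open>i > j\<close> contradicts the hypothesis on \<open>lo\<close>.\<close>

lemma len_mono:
  assumes "i \<ge> 1" and "j \<ge> 1" and le: "lo b (p ^ i) \<le> lo c (p ^ j)"
  shows "len b (p ^ i) \<le> len c (p ^ j)"
proof (cases i j rule: linorder_cases)
  case less
  have "p ^ i \<ge> 5" using power_ge_5[OF assms(1)] .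
  then show ?thesis
    using power_ratio[OF less] by (cases b; cases c; simp add: len_def hi_def lo_def; linarith)
next
  case equal
  have "p ^ j \<ge> 5" using power_ge_5[OF assms(2)] .
  then show ?thesis
    using le by (cases b; cases c; simp add: equal len_def hi_def lo_def; linarith)
next
  case greater
  have "p ^ j \<ge> 5" using power_ge_5[OF assms(2)] .
  then show ?thesis
    using le power_ratio[OF greater] by (cases b; cases c; simp add: lo_def; linarith)
qed

lemma infinite_zero_runs: "infinite {I. zero_run p I}"
proof
  assume "finite {I. zero_run p I}"
  then have fin: "finite (Inf ` {I. zero_run p I})" by simp
  have mem: "lo True (p ^ j) \<in> Inf ` {I. zero_run p I}" if "j \<ge> 1" for j
  proof (rule image_eqI)
    \<comment> \<open>The flag \<open>True\<close> is chosen because this gap is never empty,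
      whereas the other one is for \<open>p ^ j = 5\<close>.\<close>
    have pos: "lo True (p ^ j) + 1 < hi True (p ^ j)"
      using power_ge_5[OF that] by (simp add: lo_def hi_def)
    show "{lo True (p ^ j)..<hi True (p ^ j) - 1} \<in> {I. zero_run p I}"
      using zero_run_initial[OF that pos] by simp
    show "lo True (p ^ j) = Inf {lo True (p ^ j)..<hi True (p ^ j) - 1}"
      using pos by (intro Inf_Ico[symmetric]) linarith
  qed
  define m where "m = 2 * Max (Inf ` {I. zero_run p I}) + 1"
  have "m < p ^ m" using p5 by (intro power_gt_expt) auto
  moreover have "lo True (p ^ m) \<le> Max (Inf ` {I. zero_run p I})"
    by (rule Max_ge[OF fin mem]) (simp add: m_def)
  ultimately show False by (simp add: m_def lo_def)
qed

theorem record_values_zero_run_length: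
  "record_values (zero_run_length p) = {len b (p ^ j) | b j. j \<ge> 1 \<and> len b (p ^ j) > 0}"
proof (intro equalityI subsetI)
  fix x assume "x \<in> record_values (zero_run_length p)"
  then obtain i where "i \<ge> 1" and x: "x = zero_run_length p i"
    by (auto simp: record_values_def is_record_def)
  obtain I where I: "is_ith_zero_run p i I"
    using ex_ith_zero_run[OF infinite_zero_runs \<open>i \<ge> 1\<close>] by blast
  then have "zero_run p I" by (simp add: is_ith_zero_run_def)
  from zero_run_form[OF this] obtain j a b where "j \<ge> 1" "lo b (p ^ j) + 1 < hi b (p ^ j)"
    "I = {a * p ^ j + lo b (p ^ j)..<a * p ^ j + hi b (p ^ j) - 1}" by metis
  then show "x \<in> {len b (p ^ j) | b j. j \<ge> 1 \<and> len b (p ^ j) > 0}"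
    using zero_run_length_eq[OF I] by (auto simp: x len_def intro!: exI[of _ b] exI[of _ j])
next
  fix x assume "x \<in> {len b (p ^ j) | b j. j \<ge> 1 \<and> len b (p ^ j) > 0}"
  then obtain b j where j: "j \<ge> 1" and x: "x = len b (p ^ j)" and pos: "lo b (p ^ j) + 1 < hi b (p ^ j)"
    by (auto simp: len_def)
  define I where "I = {lo b (p ^ j)..<hi b (p ^ j) - 1}"
  have run: "zero_run p I" unfolding I_def by (rule zero_run_initial[OF j pos])
  \<comment> \<open>The position of the initial run is simply read off from the number of its
    predecessors; no formula for it is needed.\<close>
  define k where "k = card {J. zero_run p J \<and> left_of J I} + 1"
  have k: "is_ith_zero_run p k I" using run by (simp add: k_def is_ith_zero_run_def)
  have x': "zero_run_length p k = x"
    using zero_run_length_eq[OF k] by (simp add: I_def x len_def)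
  have "zero_run_length p i \<le> x" if i: "1 \<le> i" "i < k" for i
  proof -
    obtain J where J: "is_ith_zero_run p i J"
      using ex_ith_zero_run[OF infinite_zero_runs i(1)] by blast
    then have "zero_run p J" by (simp add: is_ith_zero_run_def)
    from zero_run_form[OF this] obtain l a c where l: "l \<ge> 1" "lo c (p ^ l) + 1 < hi c (p ^ l)"
      "J = {a * p ^ l + lo c (p ^ l)..<a * p ^ l + hi c (p ^ l) - 1}" by metis
    have "left_of J I" by (rule is_ith_zero_run_left_of[OF J k i(2)])
    moreover have "a * p ^ l + lo c (p ^ l) \<in> J" "lo b (p ^ j) \<in> I"
      using l pos by (auto simp: I_def)
    \<comment> \<open>Dropping the shift \<open>a * p ^ l\<close> only moves the earlier run further
      left, so it suffices to compare first gaps.\<close>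
    ultimately have "lo c (p ^ l) \<le> lo b (p ^ j)" by (fastforce simp: left_of_def)
    from len_mono[OF l(1) j this] show ?thesis
      using zero_run_length_eq[OF J] by (simp add: l(3) len_def x)
  qed
  moreover have "k \<ge> 1" by (simp add: k_def)
  ultimately have "is_record (zero_run_length p) k"
    unfolding is_record_def x' by blast
  then show "x \<in> record_values (zero_run_length p)"
    using x' by (auto simp: record_values_def)
qed

end

section \<open>Closed forms for the lengths\<close>

text \<open>A level is odd and prime to 3, hence \<open>6 * k + 1\<close> or
  \<open>6 * k + 5\<close>; in terms of \<open>k\<close> all floors become linear.\<close>

lemma len_6k:
  "k \<ge> 1 \<Longrightarrow> len False (6 * k + 1) = k" "k \<ge> 1 \<Longrightarrow> len True (6 * k + 1) = 2 * k - 1"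
  "len False (6 * k + 5) = k" "len True (6 * k + 5) = 2 * k + 1"
proof -
  have "(6 * k + 1 + 1) div 2 = 3 * k + 1" "(6 * k + 1 + 1) div 3 = 2 * k"
    "(2 * (6 * k + 1) + 1) div 3 = 4 * k + 1" "(6 * k + 5 + 1) div 2 = 3 * k + 3"
    "(6 * k + 5 + 1) div 3 = 2 * k + 2" "(2 * (6 * k + 5) + 1) div 3 = 4 * k + 3"
    by presburger+
  note eqs = this
  show "k \<ge> 1 \<Longrightarrow> len False (6 * k + 1) = k" "k \<ge> 1 \<Longrightarrow> len True (6 * k + 1) = 2 * k - 1"
    "len False (6 * k + 5) = k" "len True (6 * k + 5) = 2 * k + 1"
    unfolding len_def lo_def hi_def if_True if_False eqs by linarith+
qed

lemma len_mod_3: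
  assumes "odd q" and "q \<ge> 5"
  shows "q mod 3 = 1 \<Longrightarrow> real (len False q) = (real q - 1) / 6"
    and "q mod 3 = 1 \<Longrightarrow> real (len True q) = (real q - 4) / 3"
    and "q mod 3 = 2 \<Longrightarrow> real (len False q) = (real q - 5) / 6"
    and "q mod 3 = 2 \<Longrightarrow> real (len True q) = (real q - 2) / 3"
proof -
  define k where "k = q div 6"
  have 1: "q = 6 * k + 1 \<and> k \<ge> 1" if "q mod 3 = 1"
    using assms that unfolding k_def by presburger
  have 2: "q = 6 * k + 5" if "q mod 3 = 2"
    using assms that unfolding k_def by presburger
  show "q mod 3 = 1 \<Longrightarrow> real (len False q) = (real q - 1) / 6"
    "q mod 3 = 1 \<Longrightarrow> real (len True q) = (real q - 4) / 3"
    using 1 len_6k(1,2)[of k] by (auto simp: of_nat_diff)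
  show "q mod 3 = 2 \<Longrightarrow> real (len False q) = (real q - 5) / 6"
    "q mod 3 = 2 \<Longrightarrow> real (len True q) = (real q - 2) / 3"
    using 2 len_6k(3,4)[of k] by auto
qed

lemma power_mod_3_eq:
  fixes p :: nat
  shows "p mod 3 = 1 \<Longrightarrow> p ^ r mod 3 = 1"
    and "p mod 3 = 2 \<Longrightarrow> p ^ r mod 3 = (if even r then 1 else 2)"
proof -
  show "p ^ r mod 3 = 1" if "p mod 3 = 1"
    using power_mod[of p 3 r] that by simp
  show "p ^ r mod 3 = (if even r then 1 else 2)" if "p mod 3 = 2"
  proof (induction r)
    case (Suc r)
    have "p ^ Suc r mod 3 = (p mod 3) * (p ^ r mod 3) mod 3" by (simp add: mod_mult_eq)
    then show ?case using Suc that by (auto split: if_splits)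
  qed simp
qed

theorem theorem5p5:
  fixes p :: nat
  assumes "prime p" and "p \<ge> 5"
  shows "([p = 1] (mod 3) \<longrightarrow>
           real ` record_values (zero_run_length p) =
             {x. x > 0 \<and> (\<exists>r::nat. r \<ge> 1 \<and> (x = (real p ^ r - 1) / 6 \<or> x = (real p ^ r - 4) / 3))})
       \<and> ([p = 2] (mod 3) \<longrightarrow>
           real ` record_values (zero_run_length p) =
             {(real p ^ r - 5) / 6 | r::nat. odd r \<and> r \<ge> 1 \<and> (p, r) \<noteq> (5, 1)}
             \<union> {(real p ^ r - 2) / 3 | r::nat. odd r \<and> r \<ge> 1}
             \<union> {(real p ^ r - 1) / 6 | r::nat. even r \<and> r \<ge> 2}
             \<union> {(real p ^ r - 4) / 3 | r::nat. even r \<and> r \<ge> 2})"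
proof (intro conjI impI)
  note len = len_mod_3[OF odd_power[OF assms] power_ge_5[OF assms], unfolded of_nat_power]
  have records: "real ` record_values (zero_run_length p)
      = {x. x > 0 \<and> (\<exists>r\<ge>1. x = real (len False (p ^ r)) \<or> x = real (len True (p ^ r)))}"
  proof -
    have "real ` record_values (zero_run_length p)
        = {real (len b (p ^ r)) | b r. r \<ge> 1 \<and> len b (p ^ r) > 0}"
      unfolding record_values_zero_run_length[OF assms] by blast
    then show ?thesis by (auto simp: ex_bool_eq)
  qed
  {
    assume "[p = 1] (mod 3)"
    then have "p ^ r mod 3 = 1" for r
      using power_mod_3_eq(1)[of p r] by (simp add: cong_def)
    then show "real ` record_values (zero_run_length p) =
             {x. x > 0 \<and> (\<exists>r::nat. r \<ge> 1 \<and> (x = (real p ^ r - 1) / 6 \<or> x = (real p ^ r - 4) / 3))}"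
      unfolding records using len(1,2) by (intro Collect_cong) metis
  }
  assume "[p = 2] (mod 3)"
  then have mod: "p ^ r mod 3 = (if even r then 1 else 2)" for r
    using power_mod_3_eq(2)[of p r] by (simp add: cong_def)
  have five: "p ^ r = 5 \<longleftrightarrow> (p, r) = (5, 1)" if "r \<ge> 1" for r
  proof
    assume "p ^ r = 5"
    have "\<not> 2 \<le> r"
    proof
      assume "2 \<le> r"
      then have "p ^ 2 \<le> p ^ r" using assms(2) by (intro power_increasing) auto
      moreover have "5 ^ 2 \<le> p ^ 2" using assms(2) by (rule power_mono) simp
      ultimately show False using \<open>p ^ r = 5\<close> by simp
    qed
    then show "(p, r) = (5, 1)" using \<open>p ^ r = 5\<close> \<open>r \<ge> 1\<close> by (cases "r = 1") auto
  qed auto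
  have ge: "real p ^ r \<ge> 5" if "r \<ge> 1" for r
    using power_ge_5[OF assms that] by (simp flip: of_nat_power)
  \<comment> \<open>This isolates the exceptional pair: \<open>(p ^ r - 5) / 6\<close> is the only
    one of the four expressions that can vanish for \<open>p ^ r \<ge> 5\<close>.\<close>
  have pos: "real p ^ r > 5 \<longleftrightarrow> (p, r) \<noteq> (5, 1)" if "r \<ge> 1" for r
    using five[OF that] power_ge_5[OF assms that]
    by (metis le_neq_implies_less less_irrefl of_nat_less_iff of_nat_numeral of_nat_power)
  have even2: "r \<ge> 1 \<longleftrightarrow> r \<ge> 2" if "even r" for r :: nat
    using that by (cases "r = 1") auto
  let ?P = "\<lambda>x r. odd r \<and> (p, r) \<noteq> (5, 1) \<and> x = (real p ^ r - 5) / 6 \<or> odd r \<and> x = (real p ^ r - 2) / 3 \<or>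
      even r \<and> x = (real p ^ r - 1) / 6 \<or> even r \<and> x = (real p ^ r - 4) / 3"
  \<comment> \<open>Positivity of \<open>x\<close> is absorbed into the exclusion of
    \<open>(5, 1)\<close>; the parity of \<open>r\<close> selects the residue of
    \<open>p ^ r\<close> modulo 3.\<close>
  have P: "x > 0 \<and> (x = real (len False (p ^ r)) \<or> x = real (len True (p ^ r))) \<longleftrightarrow> ?P x r"
    if r: "r \<ge> 1" for x r
    using len[OF r] mod[of r] ge[OF r] pos[OF r] by (cases "even r") auto
  have "x > 0 \<and> (\<exists>r\<ge>1. x = real (len False (p ^ r)) \<or> x = real (len True (p ^ r)))
      \<longleftrightarrow> (\<exists>r\<ge>1. ?P x r)" for x
    using P by blast
  then have "real ` record_values (zero_run_length p) = {x. \<exists>r\<ge>1. ?P x r}"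
    unfolding records by simp
  also have "\<dots> = {(real p ^ r - 5) / 6 | r::nat. odd r \<and> r \<ge> 1 \<and> (p, r) \<noteq> (5, 1)}
             \<union> {(real p ^ r - 2) / 3 | r::nat. odd r \<and> r \<ge> 1}
             \<union> {(real p ^ r - 1) / 6 | r::nat. even r \<and> r \<ge> 1}
             \<union> {(real p ^ r - 4) / 3 | r::nat. even r \<and> r \<ge> 1}"
    by blast
  finally show "real ` record_values (zero_run_length p) =
             {(real p ^ r - 5) / 6 | r::nat. odd r \<and> r \<ge> 1 \<and> (p, r) \<noteq> (5, 1)}
             \<union> {(real p ^ r - 2) / 3 | r::nat. odd r \<and> r \<ge> 1}
             \<union> {(real p ^ r - 1) / 6 | r::nat. even r \<and> r \<ge> 2}
             \<union> {(real p ^ r - 4) / 3 | r::nat. even r \<and> r \<ge> 2}"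
    by (simp only: even2 cong: conj_cong)
qed

end
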